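(* Let $n\ge 1$ and $N\ge 3$ be integers and $T>0$ a real number. Let $1=\beta_0>\beta_1\ge\cdots\ge\beta_{|\chi|-1}>-1$ be the eigenvalues of the transition matrix $P$ of the Gibbs sampler for the one-dimensional Ising model with $N$ states on $n$ sites at temperature $T$. Then for every $j\in\{1,\dots,|\chi|-1\}$, $$|\beta_j| < 1-\frac{N}{n^{2}}\cdot\frac{e^{-4/T}}{1+(N-1)e^{-4/T}}.$$ In particular, for $N=3$ one has $|\beta_j|<1-\frac{3}{n^2}\cdot\frac{e^{-4/T}}{1+2e^{-4/T}}$ for every $j\in\{1,\dots,|\chi|-1\}$.
   Context: Let $c^{(1)},\dots,c^{(N)}$ be $N$ distinct states (colors) and let $\chi=\{c^{(1)},\dots,c^{(N)}\}^n$. The one-dimensional Ising model with $N$ states on $n$ sites at temperature $T>0$ is the probability measure on $\chi$ given by $$\pi(x)=\frac{1}{Z_T}\exp\Big\{\frac1T\sum_{k=1}^{n-1}\big(\mathbf 1_{\{x_k=x_{k+1}\}}-\mathbf 1_{\{x_k\ne x_{k+1}\}}\big)\Big\},\qquad x=(x_1,\dots,x_n)\in\chi,$$ where $Z_T=\sum_{x\in\chi}\exp\{\frac1T\sum_{k=1}^{n-1}(\mathbf 1_{\{x_k=x_{k+1}\}}-\mathbf 1_{\{x_k\ne x_{k+1}\}})\}$ is the normalizing constant (an empty sum is $0$). For $x\in\chi$, a site $i\in\{1,\dots,n\}$ and a color $y_i$, set $$\pi(y_i\mid x)=\frac{\pi(x_1,\dots,x_{i-1},y_i,x_{i+1},\dots,x_n)}{\sum_{l=1}^{N}\pi(x_1,\dots,x_{i-1},c^{(l)},x_{i+1},\dots,x_n)}.$$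 The Gibbs sampler chooses a coordinate uniformly at random and updates it according to its conditional probability given the other coordinates. Its transition matrix $P$ on $\chi$ is: $P(x,y)=\frac1n\,\pi(y_i\mid x)$ if $x_i\neq y_i$ and $x_j=y_j$ for all $j\ne i$ (for some site $i$); $P(x,x)=1-\frac1n\sum_{i=1}^n\sum_{y_i\neq x_i}\pi(y_i\mid x)$, where the inner sum is over colors $y_i$ different from $x_i$; and $P(x,y)=0$ otherwise. The matrix $P$ is irreducible and reversible with respect to $\pi$, so its eigenvalues are real; they are counted with multiplicity. *)

theory Defs
  imports "Jordan_Normal_Form.Char_Poly"
begin

text \<open>
  A configuration is a list of length \<open>n\<close> over the list \<open>cs\<close> of colors; sites are
  numbered \<open>0, \<dots>, n - 1\<close>.
\<close>

definition configs :: "'c list \<Rightarrow> nat \<Rightarrow> 'c list set" where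
  "configs cs n = {x. length x = n \<and> set x \<subseteq> set cs}"

definition ising_weight :: "nat \<Rightarrow> real \<Rightarrow> 'c list \<Rightarrow> real" where
  "ising_weight n T x =
     exp (1 / T * (\<Sum>k<n - 1. of_bool (x ! k = x ! (k + 1)) - of_bool (x ! k \<noteq> x ! (k + 1))))"

definition ising :: "'c list \<Rightarrow> nat \<Rightarrow> real \<Rightarrow> 'c list \<Rightarrow> real" where
  "ising cs n T x = ising_weight n T x / (\<Sum>z\<in>configs cs n. ising_weight n T z)"

definition ising_cond :: "'c list \<Rightarrow> nat \<Rightarrow> real \<Rightarrow> 'c list \<Rightarrow> nat \<Rightarrow> 'c \<Rightarrow> real" where
  "ising_cond cs n T x i c = ising cs n T (x[i := c]) / (\<Sum>d\<in>set cs. ising cs n T (x[i := d]))"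

definition differ_only_at :: "nat \<Rightarrow> 'c list \<Rightarrow> 'c list \<Rightarrow> nat \<Rightarrow> bool" where
  "differ_only_at n x y i \<longleftrightarrow> i < n \<and> x ! i \<noteq> y ! i \<and> (\<forall>j<n. j \<noteq> i \<longrightarrow> x ! j = y ! j)"

definition gibbs :: "'c list \<Rightarrow> nat \<Rightarrow> real \<Rightarrow> 'c list \<Rightarrow> 'c list \<Rightarrow> real" where
  "gibbs cs n T x y =
     (if x = y then 1 - 1 / real n * (\<Sum>i<n. \<Sum>c\<in>set cs - {x ! i}. ising_cond cs n T x i c)
      else if \<exists>i. differ_only_at n x y i
        then let i = (THE i. differ_only_at n x y i) in 1 / real n * ising_cond cs n T x i (y ! i)
      else 0)"

text \<open>
  For distinct \<open>cs\<close>, the list \<open>List.n_lists n cs\<close> enumerates \<open>configs cs n\<close> without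
  repetitions; it fixes the order of the rows and columns.
\<close>

definition gibbs_matrix :: "'c list \<Rightarrow> nat \<Rightarrow> real \<Rightarrow> real mat" where
  "gibbs_matrix cs n T =
     (let X = List.n_lists n cs
      in mat (length X) (length X) (\<lambda>(a, b). gibbs cs n T (X ! a) (X ! b)))"

lemma set_n_lists_eq_configs: "set (List.n_lists n cs) = configs cs n"
  by (auto simp: configs_def set_n_lists)

text \<open>
  The real eigenvalues of a matrix, listed in decreasing order with algebraic multiplicity.  The
  list is as long as the dimension of the matrix exactly if all complex eigenvalues are real.
\<close>

definition eigenvalues_desc :: "real mat \<Rightarrow> real list" where
  "eigenvalues_desc A = rev (sorted_list_of_multiset (proots (char_poly A)))"

end

theory Submission
  imports Defs "Jordan_Normal_Form.Schur_Decomposition" "HOL-Analysis.Convex"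
begin

text \<open>
  Resampling one site from its conditional law is a conditional expectation, hence an orthogonal
  projection in \<open>L\<^sup>2(\<pi>)\<close>, and \<open>P\<close> is the average of these \<open>n\<close> projections.  So \<open>P\<close> is
  self-adjoint and positive semidefinite: all eigenvalues are real and nonnegative, and only a
  spectral gap has to be proved, that is, a Poincare inequality bounding the variance of \<open>f\<close> by the
  Dirichlet form \<open>\<langle>(1 - P) f, f\<rangle>\<close>, which is \<open>1 / n\<close> times the sum of the mean local variances.

  Write the variance as half the double sum of \<open>\<pi>(x) \<pi>(y) (f x - f y)\<^sup>2\<close> and walk from \<open>x\<close> to \<open>y\<close> by
  replacing the sites from left to right.  The walk passes through
  \<open>(y\<^sub>1, \<dots>, y\<^sub>i, x\<^sub>i\<^sub>+\<^sub>1, \<dots>, x\<^sub>n)\<close>, and a weighted Cauchy-Schwarz inequality splits \<open>(f x - f y)\<^sup>2\<close> into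
  the squared increments of the single replacements.  After division of the bond weights by
  their common row sum, \<open>\<pi>\<close> is a stationary Markov chain with uniform marginals and symmetric
  transition kernel \<open>q\<close>.  Hence the parts of \<open>x\<close> and \<open>y\<close> that are invisible at the \<open>i\<close>-th replacement sum
  out to \<open>1\<close>, and what remains is compared with the local variance at \<open>i\<close>, up to the factor
  \<open>\<kappa>\<^sub>i / N\<close>, where \<open>\<kappa>\<^sub>i\<close> bounds the ratios
  \<open>(\<Sum>d. q(l, d) q(d, c)) / (q(l, a) q(b, c))\<close> (\<open>replacement_le_local_variance\<close>, \<open>poincare\<close>).

  For the Ising bonds, \<open>\<kappa> = exp (4 / T) + N - 1\<close> works at every site, and
  \<open>N / \<kappa> = N exp (- 4 / T) / (1 + (N - 1) exp (- 4 / T))\<close> is exactly the constant in the bound.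
  With this choice alone the estimate would not be strict.  The leftmost site has no bond to its
  left and satisfies the bound with the smaller constant \<open>exp (2 / T) + N - 1\<close>; as the final estimate
  involves only the sum of the \<open>\<kappa>\<^sub>i\<close>, this makes it strict.

  The passage from eigenfunctions to the list of roots of the characteristic polynomial uses two
  facts about a reversible matrix: its characteristic polynomial splits over the reals, and an
  eigenvalue with a one-dimensional eigenspace is a simple root
  (\<open>char_poly_reversible_splits\<close>, \<open>count_proots_char_poly_reversible_le_1\<close>).
\<close>

section \<open>Reversible matrices\<close>

text \<open>
  The weighted Hermitian form \<open>\<Sum>i. d i * (A v) i * cnj (v i)\<close> equals its own conjugate by detailed
  balance, and it equals \<open>l\<close> times a positive number if \<open>v\<close> is an eigenvector for \<open>l\<close>.
\<close>

lemma eigenvalue_reversible_real: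
  fixes A :: "real mat" and d :: "nat \<Rightarrow> real"
  assumes A: "A \<in> carrier_mat m m"
    and d: "\<And>i. i < m \<Longrightarrow> d i > 0"
    and rev: "\<And>i j. i < m \<Longrightarrow> j < m \<Longrightarrow> d i * A $$ (i, j) = d j * A $$ (j, i)"
    and ev: "eigenvalue (map_mat complex_of_real A) l"
  shows "l \<in> \<real>"
proof -
  from ev obtain v where v: "v \<in> carrier_vec m" "v \<noteq> 0\<^sub>v m"
    "map_mat complex_of_real A *\<^sub>v v = l \<cdot>\<^sub>v v"
    using A unfolding eigenvalue_def eigenvector_def by auto
  have Av: "(\<Sum>j<m. of_real (A $$ (i, j)) * v $ j) = l * v $ i" if "i < m" for i
  proof -
    have "(map_mat complex_of_real A *\<^sub>v v) $ i = (\<Sum>j<m. of_real (A $$ (i, j)) * v $ j)"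
      using that A v(1) by (auto simp: scalar_prod_def lessThan_atLeast0 intro!: sum.cong)
    then show ?thesis using v that by simp
  qed
  define q where "q = (\<Sum>i<m. d i * (cmod (v $ i))\<^sup>2)"
  define S where "S = (\<Sum>i<m. \<Sum>j<m. of_real (d i * A $$ (i, j)) * v $ j * cnj (v $ i))"
  have "S = (\<Sum>i<m. of_real (d i) * (l * v $ i) * cnj (v $ i))"
    unfolding S_def Av[symmetric, OF lessThan_iff[THEN iffD1]]
    by (intro sum.cong) (auto simp: Av[symmetric] sum_distrib_left sum_distrib_right mult_ac)
  also have "\<dots> = l * of_real q"
    unfolding q_def of_real_sum sum_distrib_left
    by (intro sum.cong) (auto simp: complex_norm_square mult_ac simp del: of_real_power)
  finally have S: "S = l * of_real q" .
  have "cnj S = (\<Sum>i<m. \<Sum>j<m. of_real (d j * A $$ (j, i)) * cnj (v $ j) * v $ i)"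
    unfolding S_def cnj_sum by (intro sum.cong refl) (simp add: rev)
  also have "\<dots> = S"
    unfolding S_def by (subst sum.swap) (simp add: mult_ac)
  finally have "S \<in> \<real>" by (simp add: Reals_cnj_iff)
  moreover obtain i where i: "i < m" "v $ i \<noteq> 0"
    using v(1,2) by (metis carrier_vecD eq_vecI index_zero_vec(1) index_zero_vec(2))
  have "q > 0" unfolding q_def
    by (rule sum_pos2[of _ i]) (use i d in \<open>auto simp: less_imp_le\<close>)
  then have "l = S / of_real q" using S by simp
  ultimately show ?thesis by simp
qed

text \<open>
  Over the complex numbers the characteristic polynomial is a product of linear factors; their roots
  are real, so the factorization descends to the reals by injectivity of the embedding.
\<close>

lemma char_poly_reversible_splits:
  fixes A :: "real mat" and d :: "nat \<Rightarrow> real"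
  assumes A: "A \<in> carrier_mat m m"
    and d: "\<And>i. i < m \<Longrightarrow> d i > 0"
    and rev: "\<And>i j. i < m \<Longrightarrow> j < m \<Longrightarrow> d i * A $$ (i, j) = d j * A $$ (j, i)"
  shows "\<exists>es. char_poly A = (\<Prod>e\<leftarrow>es. [:- e, 1:]) \<and> length es = m"
proof -
  let ?C = "map_mat complex_of_real A"
  have C: "?C \<in> carrier_mat m m" using A by simp
  from char_poly_factorized[OF C] obtain as
    where as: "char_poly ?C = (\<Prod>a\<leftarrow>as. [:- a, 1:])" "length as = m" by auto
  have real: "of_real (Re a) = a" if "a \<in> set as" for a
  proof -
    have "eigenvalue ?C a"
      unfolding eigenvalue_root_char_poly[OF C] as(1) using that
      by (auto simp: poly_prod_list prod_list_zero_iff o_def)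
    from eigenvalue_reversible_real[OF A d rev this] show ?thesis by simp
  qed
  interpret h: map_poly_inj_idom_hom complex_of_real ..
  have "map_poly complex_of_real (char_poly A) = char_poly ?C"
    by (rule of_real_hom.char_poly_hom[OF A, symmetric])
  also have "\<dots> = (\<Prod>a\<leftarrow>map Re as. map_poly complex_of_real [:- a, 1:])"
    unfolding as(1) map_map o_def by (intro arg_cong[of _ _ prod_list] map_cong) (auto simp: real)
  also have "\<dots> = map_poly complex_of_real (\<Prod>a\<leftarrow>map Re as. [:- a, 1:])"
    by (simp add: h.hom_prod_list o_def)
  finally show ?thesis using as(2) by (intro exI[of _ "map Re as"]) (simp add: h.eq_iff)
qed

lemma proots_prod_linear: "proots (\<Prod>e\<leftarrow>es. [:- e, 1:]) = mset (es :: 'a :: idom list)"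
  by (induction es) (simp_all add: proots_mult prod_list_zero_iff image_iff del: mult_pCons_left)

text \<open>
  Were \<open>e\<close> a double root, a Schur decomposition could start with the diagonal entries \<open>e, e\<close>.  Its
  first two basis vectors \<open>v\<^sub>0\<close>, \<open>v\<^sub>1\<close> then satisfy \<open>A v\<^sub>0 = e v\<^sub>0\<close> and \<open>A v\<^sub>1 = b v\<^sub>0 + e v\<^sub>1\<close>.  Pairing the
  second equation with \<open>v\<^sub>0\<close> in the \<open>d\<close>-weighted inner product, in which \<open>A\<close> is self-adjoint, gives
  \<open>b = 0\<close>, so the eigenspace would be at least two-dimensional.
\<close>

lemma count_proots_char_poly_reversible_le_1:
  fixes A :: "real mat" and d :: "nat \<Rightarrow> real"
  assumes A: "A \<in> carrier_mat m m"
    and d: "\<And>i. i < m \<Longrightarrow> d i > 0"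
    and rev: "\<And>i j. i < m \<Longrightarrow> j < m \<Longrightarrow> d i * A $$ (i, j) = d j * A $$ (j, i)"
    and line: "\<And>v. (\<And>i. i < m \<Longrightarrow> (\<Sum>j<m. A $$ (i, j) * v j) = e * v i) \<Longrightarrow>
      \<exists>c. \<forall>i<m. v i = c * u i"
  shows "count (proots (char_poly A)) e \<le> 1"
proof (rule ccontr)
  assume "\<not> ?thesis"
  from char_poly_reversible_splits[OF A d rev] obtain es
    where es: "char_poly A = (\<Prod>e\<leftarrow>es. [:- e, 1:])" "length es = m" by blast
  have pr: "proots (char_poly A) = mset es"
    unfolding es(1) by (rule proots_prod_linear)
  have cnt: "count (mset es) e \<ge> 2" using \<open>\<not> _\<close> pr by simp
  define fs where "fs = e # e # remove1 e (remove1 e es)"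
  have fs: "mset fs = mset es"
    using cnt unfolding fs_def by (intro multiset_eqI) (auto simp: )
  have "char_poly A = (\<Prod>e\<leftarrow>fs. [:- e, 1:])"
    unfolding es(1) prod_mset_prod_list[symmetric] mset_map fs ..
  moreover obtain B P Q where BPQ: "schur_decomposition A fs = (B, P, Q)"
    by (cases "schur_decomposition A fs")
  ultimately have sim: "similar_mat_wit A B P Q" and ut: "upper_triangular B"
    and dg: "diag_mat B = fs"
    using schur_decomposition[OF A] by blast+
  note S = similar_mat_witD2[OF A sim]
  have m2: "m \<ge> 2"
    using arg_cong[OF dg, of length] S(5) by (simp add: diag_mat_def fs_def)
  have B0: "B $$ (0, 0) = e" and B1: "B $$ (1, 1) = e"
    using arg_cong[OF dg, of "\<lambda>l. l ! 0"] arg_cong[OF dg, of "\<lambda>l. l ! 1"] S(5) m2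
    by (simp_all add: diag_mat_def fs_def)
  have Bl: "B $$ (i, j) = 0" if "j < i" "i < m" for i j
    using ut S(5) that by (auto simp: upper_triangular_def)
  have "A * P = P * B * (Q * P)"
    unfolding S(3) by (rule assoc_mult_mat[OF mult_carrier_mat[OF S(6,5)] S(7,6)])
  also have "\<dots> = P * B"
    unfolding S(2) by (rule right_mult_one_mat[OF mult_carrier_mat[OF S(6,5)]])
  finally have AP: "A * P = P * B" .
  have AP': "(\<Sum>j<m. A $$ (i, j) * P $$ (j, k)) = (\<Sum>j<m. P $$ (i, j) * B $$ (j, k))"
    if "i < m" "k < m" for i k
    using arg_cong[OF AP, of "\<lambda>M. M $$ (i, k)"] that A S
    by (simp add: scalar_prod_def lessThan_atLeast0)
  \<comment> \<open>The two basis vectors are the columns \<open>0\<close> and \<open>1\<close> of \<open>P\<close>.\<close>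
  define b where "b = B $$ (0, 1)"
  have c0: "(\<Sum>j<m. A $$ (i, j) * P $$ (j, 0)) = e * P $$ (i, 0)" if "i < m" for i
  proof -
    have "(\<Sum>j<m. P $$ (i, j) * B $$ (j, 0)) = (\<Sum>j\<in>{0}. P $$ (i, j) * B $$ (j, 0))"
      using m2 by (intro sum.mono_neutral_right) (auto simp: Bl)
    then show ?thesis using AP'[OF that, of 0] m2 B0 by simp
  qed
  have c1: "(\<Sum>j<m. A $$ (i, j) * P $$ (j, 1)) = b * P $$ (i, 0) + e * P $$ (i, 1)"
    if "i < m" for i
  proof -
    have "(\<Sum>j<m. P $$ (i, j) * B $$ (j, 1)) = (\<Sum>j\<in>{0,1}. P $$ (i, j) * B $$ (j, 1))"
      using m2 by (intro sum.mono_neutral_right) (auto simp: Bl)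
    then show ?thesis using AP'[OF that, of 1] m2 B1 by (simp add: b_def)
  qed
  have QP: "(\<Sum>j<m. Q $$ (i, j) * P $$ (j, k)) = (if i = k then 1 else 0)"
    if "i < m" "k < m" for i k
    using arg_cong[OF S(2), of "\<lambda>M. M $$ (i, k)"] that S(6,7)
    by (simp add: scalar_prod_def lessThan_atLeast0)
  have "\<exists>j<m. P $$ (j, 0) \<noteq> 0"
  proof (rule ccontr)
    assume "\<not> ?thesis"
    then show False using QP[of 0 0] m2 by simp
  qed
  then obtain j0 where j0: "j0 < m" "P $$ (j0, 0) \<noteq> 0" by blast
  define q where "q = (\<Sum>i<m. d i * (P $$ (i, 0))\<^sup>2)"
  have "q > 0" unfolding q_def
    by (rule sum_pos2[of _ j0]) (use j0 d in \<open>auto simp: less_imp_le\<close>)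
  \<comment> \<open>Self-adjointness, applied to the two columns.\<close>
  have "(\<Sum>i<m. d i * (\<Sum>j<m. A $$ (i, j) * P $$ (j, 1)) * P $$ (i, 0))
      = (\<Sum>i<m. \<Sum>j<m. d i * A $$ (i, j) * (P $$ (j, 1) * P $$ (i, 0)))"
    by (simp add: sum_distrib_left sum_distrib_right mult_ac)
  also have "\<dots> = (\<Sum>i<m. \<Sum>j<m. d j * A $$ (j, i) * (P $$ (j, 1) * P $$ (i, 0)))"
    by (intro sum.cong refl) (simp add: rev)
  also have "\<dots> = (\<Sum>j<m. d j * P $$ (j, 1) * (\<Sum>i<m. A $$ (j, i) * P $$ (i, 0)))"
    by (subst sum.swap) (simp add: sum_distrib_left sum_distrib_right mult_ac)
  finally have "(\<Sum>i<m. d i * (b * P $$ (i, 0) + e * P $$ (i, 1)) * P $$ (i, 0))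
      = (\<Sum>j<m. d j * P $$ (j, 1) * (e * P $$ (j, 0)))"
    using c0 c1 by simp
  then have "b * q = 0"
    unfolding q_def by (simp add: sum.distrib sum_distrib_left algebra_simps power2_eq_square)
  with \<open>q > 0\<close> have "b = 0" by simp
  obtain x where x: "\<And>i. i < m \<Longrightarrow> P $$ (i, 0) = x * u i" using line[OF c0] by blast
  obtain y where y: "\<And>i. i < m \<Longrightarrow> P $$ (i, 1) = y * u i"
    using line[of "\<lambda>i. P $$ (i, 1)"] c1 \<open>b = 0\<close> by auto
  \<comment> \<open>Both columns are multiples of \<open>u\<close>, which contradicts the invertibility of \<open>P\<close>, with inverse \<open>Q\<close>.\<close>
  have eq: "(\<Sum>j<m. Q $$ (i, j) * (y * P $$ (j, 0))) = (\<Sum>j<m. Q $$ (i, j) * (x * P $$ (j, 1)))"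
    for i
    by (intro sum.cong refl) (simp add: x y[simplified])
  have "y * (\<Sum>j<m. Q $$ (1, j) * P $$ (j, 0)) = x * (\<Sum>j<m. Q $$ (1, j) * P $$ (j, 1))"
    using eq[of 1] by (simp add: sum_distrib_left mult_ac)
  then have "x = 0" using QP[of 1 0] QP[of 1 1] m2 by simp
  then show False using x j0 by simp
qed

section \<open>Variances as sums over pairs\<close>

text \<open>
  Allowing an arbitrary total mass \<open>M\<close> covers both the variance under the Ising measure (\<open>M = 1\<close>) and
  the local variances, where \<open>M\<close> is the weight of a configuration with one free site.
\<close>

lemma variance_pairs:
  fixes W f :: "'a \<Rightarrow> real"
  assumes "(\<Sum>a\<in>A. W a) = M" and "M \<noteq> 0"
  shows "(\<Sum>a\<in>A. W a * (f a)\<^sup>2) - (\<Sum>a\<in>A. W a * f a)\<^sup>2 / M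
    = 1 / 2 * (\<Sum>a\<in>A. \<Sum>b\<in>A. W a * W b / M * (f a - f b)\<^sup>2)"
proof -
  have e: "W a * W b / M * (f a - f b)\<^sup>2 = (W a * (f a)\<^sup>2) * (W b / M) + W a * (W b * (f b)\<^sup>2 / M)
      - (W a * f a) * (2 * (W b * f b) / M)" for a b
    by (simp add: power2_diff power2_eq_square diff_divide_distrib add_divide_distrib algebra_simps)
  have "(\<Sum>a\<in>A. \<Sum>b\<in>A. W a * W b / M * (f a - f b)\<^sup>2)
     = (\<Sum>a\<in>A. W a * (f a)\<^sup>2) * (\<Sum>b\<in>A. W b / M) + (\<Sum>a\<in>A. W a) * (\<Sum>b\<in>A. W b * (f b)\<^sup>2 / M)
       - (\<Sum>a\<in>A. W a * f a) * (\<Sum>b\<in>A. 2 * (W b * f b) / M)"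
    unfolding e sum.distrib sum_subtractf sum_product ..
  also have "\<dots> = 2 * ((\<Sum>a\<in>A. W a * (f a)\<^sup>2) - (\<Sum>a\<in>A. W a * f a)\<^sup>2 / M)"
    using assms
    by (simp add: power2_eq_square flip: sum_divide_distrib sum_distrib_left)
  finally show ?thesis by simp
qed

lemma sum_swap3:
  "(\<Sum>a\<in>A. \<Sum>b\<in>B. \<Sum>c\<in>D. S a b c) = (\<Sum>c\<in>D. \<Sum>a\<in>A. \<Sum>b\<in>B. S a b c)"
proof -
  have "(\<Sum>a\<in>A. \<Sum>b\<in>B. \<Sum>c\<in>D. S a b c) = (\<Sum>a\<in>A. \<Sum>c\<in>D. \<Sum>b\<in>B. S a b c)"
    by (rule sum.cong[OF refl], rule sum.swap)
  then show ?thesis by (simp only: sum.swap[of _ D A])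
qed

text \<open>
  Unequal weights let cheap replacements contribute less to the first factor; a strict inequality in
  the end comes from the one site that is cheaper than the others.
\<close>

lemma weighted_Cauchy_Schwarz:
  fixes a \<kappa> :: "'a \<Rightarrow> real"
  assumes "\<And>i. i \<in> I \<Longrightarrow> \<kappa> i > 0"
  shows "(\<Sum>i\<in>I. a i)\<^sup>2 \<le> (\<Sum>i\<in>I. \<kappa> i) * (\<Sum>i\<in>I. (a i)\<^sup>2 / \<kappa> i)"
proof -
  have "(\<Sum>i\<in>I. a i) = (\<Sum>i\<in>I. sqrt (\<kappa> i) * (a i / sqrt (\<kappa> i)))"
    by (intro sum.cong) (auto simp: dest: assms)
  moreover have "(\<Sum>i\<in>I. (sqrt (\<kappa> i))\<^sup>2) = (\<Sum>i\<in>I. \<kappa> i)"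
    "(\<Sum>i\<in>I. (a i / sqrt (\<kappa> i))\<^sup>2) = (\<Sum>i\<in>I. (a i)\<^sup>2 / \<kappa> i)"
    by (auto intro!: sum.cong simp: power_divide less_imp_le[OF assms])
  ultimately show ?thesis
    using Cauchy_Schwarz_ineq_sum[of "\<lambda>i. sqrt (\<kappa> i)" "\<lambda>i. a i / sqrt (\<kappa> i)" I] by simp
qed

section \<open>Path weights and configurations\<close>

fun path_weight :: "('c \<Rightarrow> 'c \<Rightarrow> real) \<Rightarrow> 'c list \<Rightarrow> real" where
  "path_weight q (a # b # l) = q a b * path_weight q (b # l)"
| "path_weight q _ = 1"

text \<open>
  Cutting a path at a site assigns every bond to exactly one of the two pieces, provided that both
  contain the site.
\<close>

lemma path_weight_append: "path_weight q (u @ a # v) = path_weight q (u @ [a]) * path_weight q (a # v)"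
  by (induction q u rule: path_weight.induct) auto

lemma path_weight_snoc: "path_weight q (u @ [b, a]) = path_weight q (u @ [b]) * q b a"
  using path_weight_append[of q u b "[a]"] by simp

lemma finite_configs [simp]: "finite (configs cs n)"
  unfolding configs_def using finite_lists_length_eq[of "set cs" n] by (simp add: conj_commute)

lemma configs_0 [simp]: "configs cs 0 = {[]}"
  by (auto simp: configs_def)

lemma append_in_configs:
  "\<lbrakk>i < n; u \<in> configs cs i; a \<in> set cs; v \<in> configs cs (n - 1 - i)\<rbrakk> \<Longrightarrow> u @ a # v \<in> configs cs n"
  by (auto simp: configs_def)

lemma configs_split:
  assumes "x \<in> configs cs n" "i < n"
  obtains u a v where "x = u @ a # v" "u \<in> configs cs i" "a \<in> set cs" "v \<in> configs cs (n - 1 - i)"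
proof -
  have "x = take i x @ x ! i # drop (Suc i) x"
    using assms by (simp add: configs_def id_take_nth_drop)
  moreover have "take i x \<in> configs cs i" "x ! i \<in> set cs" "drop (Suc i) x \<in> configs cs (n - 1 - i)"
    using assms by (auto simp: configs_def dest: in_set_takeD in_set_dropD)
  ultimately show ?thesis using that by blast
qed

lemma sum_configs_split:
  assumes "i < n"
  shows "(\<Sum>x\<in>configs cs n. F x)
    = (\<Sum>u\<in>configs cs i. \<Sum>a\<in>set cs. \<Sum>v\<in>configs cs (n - 1 - i). F (u @ a # v))"
proof -
  let ?g = "\<lambda>(u, a, v). u @ a # v"
  let ?D = "configs cs i \<times> set cs \<times> configs cs (n - 1 - i)"
  have "bij_betw ?g ?D (configs cs n)"
    unfolding bij_betw_def
  proof
    show "inj_on ?g ?D" by (auto simp: inj_on_def configs_def)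
    show "?g ` ?D = configs cs n"
    proof (intro equalityI subsetI)
      fix x assume "x \<in> configs cs n"
      from configs_split[OF this assms] obtain u a v
        where "x = u @ a # v" "(u, a, v) \<in> ?D" by blast
      then show "x \<in> ?g ` ?D" by (intro rev_image_eqI[of "(u, a, v)"]) simp_all
    qed (use assms in \<open>auto intro: append_in_configs\<close>)
  qed
  from sum.reindex_bij_betw[OF this, of F] show ?thesis
    by (simp add: sum.cartesian_product case_prod_unfold)
qed

lemma list_update_append_Cons: "length u = i \<Longrightarrow> (u @ a # v)[i := c] = u @ c # v"
  by (simp add: list_update_append)

section \<open>The Poincare inequality for chains of bonds\<close>

text \<open>
  Symmetry and unit row sums make the path weights, divided by the number of colors, the law of a
  stationary Markov chain with uniform marginals that runs alike in both directions.
\<close>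

locale bond_chain =
  fixes cs :: "'c list" and n :: nat and q :: "'c \<Rightarrow> 'c \<Rightarrow> real"
  assumes sites: "n \<ge> 1"
    and colors: "cs \<noteq> []"
    and q_pos: "\<And>a b. q a b > 0"
    and q_sym: "\<And>a b. q a b = q b a"
    and q_stoch: "\<And>a. a \<in> set cs \<Longrightarrow> (\<Sum>b\<in>set cs. q a b) = 1"
begin

abbreviation "C \<equiv> set cs"
abbreviation "X \<equiv> configs cs n"
abbreviation "K \<equiv> real (card C)"

definition \<mu> :: "'c list \<Rightarrow> real" where "\<mu> x = path_weight q x / K"

text \<open>
  The conditional expectation of \<open>f\<close> given all sites other than \<open>i\<close>.
\<close>

definition resample :: "nat \<Rightarrow> ('c list \<Rightarrow> real) \<Rightarrow> 'c list \<Rightarrow> real" where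
  "resample i f x = (\<Sum>c\<in>C. \<mu> (x[i := c]) * f (x[i := c])) / (\<Sum>c\<in>C. \<mu> (x[i := c]))"

text \<open>
  The inner product \<open>\<langle>resample i f, h\<rangle>\<close> in \<open>L\<^sup>2(\<mu>)\<close>.
\<close>

definition form :: "nat \<Rightarrow> ('c list \<Rightarrow> real) \<Rightarrow> ('c list \<Rightarrow> real) \<Rightarrow> real" where
  "form i f h = (\<Sum>x\<in>X. \<mu> x * resample i f x * h x)"

lemma K_pos: "K > 0"
  using colors by (simp add: card_gt_0_iff)

lemma path_weight_pos: "path_weight q x > 0"
  by (induction x rule: induct_list012) (auto simp: q_pos)

lemma \<mu>_pos: "\<mu> x > 0"
  unfolding \<mu>_def using K_pos path_weight_pos by simp

lemma marginal_pos: "(\<Sum>c\<in>C. \<mu> (g c)) > 0"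
  using colors by (intro sum_pos) (auto simp: \<mu>_pos)

text \<open>
  Unit row sums let the sites to the right of a fixed site be summed out one by one; by symmetry of
  the kernel the same holds on the left.
\<close>

lemma sum_path_weight_right: "a \<in> C \<Longrightarrow> (\<Sum>v\<in>configs cs m. path_weight q (a # v)) = 1"
proof (induction m arbitrary: a)
  case (Suc m)
  have "(\<Sum>v\<in>configs cs (Suc m). path_weight q (a # v))
      = (\<Sum>b\<in>C. q a b * (\<Sum>v\<in>configs cs m. path_weight q (b # v)))"
    by (subst sum_configs_split[of 0]) (auto simp: sum_distrib_left)
  also have "\<dots> = 1" using Suc q_stoch by simp
  finally show ?case .
qed simp

lemma sum_path_weight_left: "a \<in> C \<Longrightarrow> (\<Sum>u\<in>configs cs m. path_weight q (u @ [a])) = 1"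
proof (induction m arbitrary: a)
  case (Suc m)
  have "(\<Sum>u\<in>configs cs (Suc m). path_weight q (u @ [a]))
      = (\<Sum>b\<in>C. q a b * (\<Sum>u\<in>configs cs m. path_weight q (u @ [b])))"
    by (subst sum_configs_split[of m], simp)
      (subst sum.swap, simp add: sum_distrib_left path_weight_snoc q_sym[of a] mult.commute)
  also have "\<dots> = 1" using Suc q_stoch by simp
  finally show ?case .
qed simp

lemma sum_\<mu>: "(\<Sum>x\<in>X. \<mu> x) = 1"
proof -
  have "(\<Sum>x\<in>X. path_weight q x) = (\<Sum>a\<in>C. \<Sum>v\<in>configs cs (n - 1). path_weight q (a # v))"
    by (subst sum_configs_split[of 0]) (use sites in auto)
  also have "\<dots> = K" by (simp add: sum_path_weight_right)
  finally show ?thesis using colors by (simp add: \<mu>_def flip: sum_divide_distrib)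
qed

text \<open>
  Grouping the configurations by the sites other than \<open>i\<close> makes it visible that the form is symmetric
  and positive semidefinite.
\<close>

lemma form_eq:
  assumes i: "i < n"
  shows "form i f h = (\<Sum>u\<in>configs cs i. \<Sum>v\<in>configs cs (n - 1 - i).
    (\<Sum>a\<in>C. \<mu> (u @ a # v) * f (u @ a # v)) * (\<Sum>a\<in>C. \<mu> (u @ a # v) * h (u @ a # v))
      / (\<Sum>a\<in>C. \<mu> (u @ a # v)))"
proof -
  have len: "length u = i" if "u \<in> configs cs i" for u using that by (simp add: configs_def)
  have r: "resample i f (u @ a # v)
      = (\<Sum>c\<in>C. \<mu> (u @ c # v) * f (u @ c # v)) / (\<Sum>c\<in>C. \<mu> (u @ c # v))"
    if "u \<in> configs cs i" for u a v
    by (simp add: resample_def list_update_append_Cons[OF len[OF that]])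
  have pull: "(\<Sum>a\<in>C. w a * k * g a) = k * (\<Sum>a\<in>C. w a * g a)" for w g and k :: real
    by (simp add: sum_distrib_left mult_ac)
  have "form i f h = (\<Sum>u\<in>configs cs i. \<Sum>v\<in>configs cs (n - 1 - i). \<Sum>a\<in>C.
      \<mu> (u @ a # v) * resample i f (u @ a # v) * h (u @ a # v))"
    unfolding form_def by (subst sum_configs_split[OF i], rule sum.cong[OF refl], rule sum.swap)
  also have "\<dots> = (\<Sum>u\<in>configs cs i. \<Sum>v\<in>configs cs (n - 1 - i).
    (\<Sum>a\<in>C. \<mu> (u @ a # v) * f (u @ a # v)) * (\<Sum>a\<in>C. \<mu> (u @ a # v) * h (u @ a # v))
      / (\<Sum>a\<in>C. \<mu> (u @ a # v)))"
    by (intro sum.cong refl) (simp only: r pull times_divide_eq_left)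
  finally show ?thesis .
qed

lemma form_commute: "i < n \<Longrightarrow> form i f h = form i h f"
  by (simp add: form_eq mult.commute)

lemma form_nonneg: "i < n \<Longrightarrow> form i f f \<ge> 0"
  unfolding form_eq
  by (intro sum_nonneg divide_nonneg_nonneg) (auto intro: less_imp_le[OF \<mu>_pos])

lemma resample_const: "resample i (\<lambda>_. c) x = c"
  using marginal_pos[of "\<lambda>c. x[i := c]"] by (simp add: resample_def flip: sum_distrib_right)

lemma form_one: "i < n \<Longrightarrow> form i f (\<lambda>_. 1) = (\<Sum>x\<in>X. \<mu> x * f x)"
  by (subst form_commute) (simp_all add: form_def resample_const)

lemma \<mu>_split: "\<mu> (u @ a # v) = path_weight q (u @ [a]) * path_weight q (a # v) / K"
  by (simp add: \<mu>_def path_weight_append[of q u a v])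

text \<open>
  By orthogonality of the projection, \<open>\<parallel>f\<parallel>\<^sup>2 - \<langle>resample i f, f\<rangle>\<close> is the mean of the conditional variance at
  site \<open>i\<close>, to which the formula over pairs applies.
\<close>

lemma local_variance_eq:
  assumes i: "i < n"
  shows "(\<Sum>x\<in>X. \<mu> x * (f x)\<^sup>2) - form i f f = 1 / 2 *
    (\<Sum>u\<in>configs cs i. \<Sum>v\<in>configs cs (n - 1 - i). \<Sum>a\<in>C. \<Sum>b\<in>C.
      \<mu> (u @ a # v) * \<mu> (u @ b # v) / (\<Sum>c\<in>C. \<mu> (u @ c # v)) * (f (u @ a # v) - f (u @ b # v))\<^sup>2)"
proof -
  have "(\<Sum>x\<in>X. \<mu> x * (f x)\<^sup>2) = (\<Sum>u\<in>configs cs i. \<Sum>v\<in>configs cs (n - 1 - i). \<Sum>a\<in>C.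
      \<mu> (u @ a # v) * (f (u @ a # v))\<^sup>2)"
    by (subst sum_configs_split[OF i], rule sum.cong[OF refl], rule sum.swap)
  then have "(\<Sum>x\<in>X. \<mu> x * (f x)\<^sup>2) - form i f f = (\<Sum>u\<in>configs cs i. \<Sum>v\<in>configs cs (n - 1 - i).
      (\<Sum>a\<in>C. \<mu> (u @ a # v) * (f (u @ a # v))\<^sup>2)
        - (\<Sum>a\<in>C. \<mu> (u @ a # v) * f (u @ a # v))\<^sup>2 / (\<Sum>a\<in>C. \<mu> (u @ a # v)))"
    by (simp only: form_eq[OF i] sum_subtractf power2_eq_square[of "sum _ _"])
  also have "\<dots> = (\<Sum>u\<in>configs cs i. \<Sum>v\<in>configs cs (n - 1 - i). 1 / 2 * (\<Sum>a\<in>C. \<Sum>b\<in>C.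
      \<mu> (u @ a # v) * \<mu> (u @ b # v) / (\<Sum>c\<in>C. \<mu> (u @ c # v)) * (f (u @ a # v) - f (u @ b # v))\<^sup>2))"
    by (intro sum.cong refl variance_pairs less_imp_neq[THEN not_sym] marginal_pos)
  finally show ?thesis by (simp only: sum_distrib_left)
qed

text \<open>
  Split \<open>x = u @ a # v\<close> and \<open>y = u' @ b # v'\<close> at site \<open>i\<close>.  The increment depends on \<open>u'\<close>, \<open>a\<close>, \<open>b\<close>, \<open>v\<close> only, so
  \<open>u\<close> and \<open>v'\<close> sum out to \<open>1\<close>.  The remaining weight of \<open>(u', a, b, v)\<close> is the product of the path weights
  of \<open>a # v\<close> and \<open>u' @ [b]\<close>, whereas the local variance carries the weights of both \<open>u' @ a # v\<close> and
  \<open>u' @ b # v\<close>, divided by their sum over the color at \<open>i\<close>.  The quotient of the two is what the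
  assumption \<open>bond\<close> bounds; one factor \<open>1 / K\<close> is left over.
\<close>

lemma replacement_le_local_variance:
  assumes i: "i < n" and \<kappa>: "\<kappa> > 0"
    and bond: "\<And>u a b v. \<lbrakk>u \<in> configs cs i; a \<in> C; b \<in> C; v \<in> configs cs (n - 1 - i)\<rbrakk> \<Longrightarrow>
      (\<Sum>d\<in>C. path_weight q (u @ [d]) * path_weight q (d # v))
        \<le> \<kappa> * (path_weight q (u @ [a]) * path_weight q (b # v))"
  shows "(\<Sum>x\<in>X. \<Sum>y\<in>X. \<mu> x * \<mu> y *
      (f (take i y @ drop i x) - f (take (Suc i) y @ drop (Suc i) x))\<^sup>2)
    \<le> 2 * \<kappa> / K * ((\<Sum>x\<in>X. \<mu> x * (f x)\<^sup>2) - form i f f)"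
proof -
  let ?U = "configs cs i" and ?V = "configs cs (n - 1 - i)" and ?p = "path_weight q"
  define F where "F u a b v = (f (u @ a # v) - f (u @ b # v))\<^sup>2" for u a b v
  have len: "length u = i" if "u \<in> ?U" for u using that by (simp add: configs_def)
  have "(\<Sum>x\<in>X. \<Sum>y\<in>X. \<mu> x * \<mu> y *
      (f (take i y @ drop i x) - f (take (Suc i) y @ drop (Suc i) x))\<^sup>2)
    = (\<Sum>u\<in>?U. \<Sum>a\<in>C. \<Sum>v\<in>?V. \<Sum>u'\<in>?U. \<Sum>b\<in>C. \<Sum>v'\<in>?V.
        ?p (u @ [a]) * ?p (a # v) * (?p (u' @ [b]) * ?p (b # v')) / K\<^sup>2 * F u' a b v)"
    unfolding sum_configs_split[OF i, of _ cs]
    by (intro sum.cong refl) (simp add: len F_def \<mu>_split power2_eq_square)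
  also have "\<dots> = (\<Sum>u\<in>?U. \<Sum>a\<in>C. \<Sum>v\<in>?V. \<Sum>u'\<in>?U. \<Sum>b\<in>C.
        ?p (u @ [a]) * (\<Sum>v'\<in>?V. ?p (b # v')) * (?p (a # v) * ?p (u' @ [b]) / K\<^sup>2 * F u' a b v))"
    by (intro sum.cong refl) (simp add: sum_distrib_left sum_distrib_right sum_divide_distrib mult_ac)
  also have "\<dots> = (\<Sum>u\<in>?U. \<Sum>a\<in>C. ?p (u @ [a]) *
        (\<Sum>v\<in>?V. \<Sum>u'\<in>?U. \<Sum>b\<in>C. ?p (a # v) * ?p (u' @ [b]) / K\<^sup>2 * F u' a b v))"
    by (simp add: sum_path_weight_right sum_distrib_left)
  also have "\<dots> = (\<Sum>a\<in>C. \<Sum>v\<in>?V. \<Sum>u\<in>?U. \<Sum>b\<in>C. ?p (a # v) * ?p (u @ [b]) / K\<^sup>2 * F u a b v)"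
    by (subst sum.swap) (simp add: sum_path_weight_left flip: sum_distrib_right)
  also have "\<dots> \<le> (\<Sum>a\<in>C. \<Sum>v\<in>?V. \<Sum>u\<in>?U. \<Sum>b\<in>C.
      \<kappa> / K * (\<mu> (u @ a # v) * \<mu> (u @ b # v) / (\<Sum>c\<in>C. \<mu> (u @ c # v)) * F u a b v))"
  proof (intro sum_mono)
    fix a v u b assume *: "a \<in> C" "v \<in> ?V" "u \<in> ?U" "b \<in> C"
    define Z where "Z = (\<Sum>d\<in>C. ?p (u @ [d]) * ?p (d # v))"
    have Z: "Z \<le> \<kappa> * (?p (u @ [a]) * ?p (b # v))" "Z > 0"
      unfolding Z_def using bond * colors by (auto intro!: sum_pos mult_pos_pos path_weight_pos)
    have "(\<Sum>c\<in>C. \<mu> (u @ c # v)) = Z / K"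
      by (simp add: Z_def \<mu>_split sum_divide_distrib)
    then have "\<kappa> / K * (\<mu> (u @ a # v) * \<mu> (u @ b # v) / (\<Sum>c\<in>C. \<mu> (u @ c # v)))
      = (\<kappa> * (?p (u @ [a]) * ?p (b # v)) / Z) * (?p (a # v) * ?p (u @ [b]) / K\<^sup>2)"
      using Z(2) K_pos
      by (simp add: \<mu>_split power2_eq_square field_simps)
    moreover have "1 \<le> \<kappa> * (?p (u @ [a]) * ?p (b # v)) / Z" using Z by simp
    moreover have "0 \<le> ?p (a # v) * ?p (u @ [b]) / K\<^sup>2"
      by (simp add: less_imp_le[OF path_weight_pos])
    ultimately have "?p (a # v) * ?p (u @ [b]) / K\<^sup>2
        \<le> \<kappa> / K * (\<mu> (u @ a # v) * \<mu> (u @ b # v) / (\<Sum>c\<in>C. \<mu> (u @ c # v)))"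
      by (metis mult_1 mult_right_mono)
    from mult_right_mono[OF this, of "F u a b v"]
    show "?p (a # v) * ?p (u @ [b]) / K\<^sup>2 * F u a b v
        \<le> \<kappa> / K * (\<mu> (u @ a # v) * \<mu> (u @ b # v) / (\<Sum>c\<in>C. \<mu> (u @ c # v)) * F u a b v)"
      by (simp add: F_def mult_ac)
  qed
  also have "\<dots> = \<kappa> / K * (\<Sum>u\<in>?U. \<Sum>v\<in>?V. \<Sum>a\<in>C. \<Sum>b\<in>C.
      \<mu> (u @ a # v) * \<mu> (u @ b # v) / (\<Sum>c\<in>C. \<mu> (u @ c # v)) * F u a b v)"
    unfolding sum_distrib_left
    by (subst sum_swap3, intro sum.cong[OF refl], rule sum.swap)
  also have "\<dots> = 2 * \<kappa> / K * ((\<Sum>x\<in>X. \<mu> x * (f x)\<^sup>2) - form i f f)"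
    unfolding local_variance_eq[OF i] F_def by simp
  finally show ?thesis .
qed

text \<open>
  The increments along the walk from \<open>x\<close> to \<open>y\<close> telescope to \<open>f x - f y\<close>.  Choosing the weights of the
  Cauchy-Schwarz inequality equal to the replacement costs cancels the costs in the second factor.
\<close>

lemma poincare:
  assumes \<kappa>: "\<And>i. i < n \<Longrightarrow> \<kappa> i > 0"
    and bond: "\<And>i u a b v. \<lbrakk>i < n; u \<in> configs cs i; a \<in> C; b \<in> C; v \<in> configs cs (n - 1 - i)\<rbrakk> \<Longrightarrow>
      (\<Sum>d\<in>C. path_weight q (u @ [d]) * path_weight q (d # v))
        \<le> \<kappa> i * (path_weight q (u @ [a]) * path_weight q (b # v))"
  shows "(\<Sum>x\<in>X. \<mu> x * (f x)\<^sup>2) - (\<Sum>x\<in>X. \<mu> x * f x)\<^sup>2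
    \<le> (\<Sum>i<n. \<kappa> i) / K * (\<Sum>i<n. (\<Sum>x\<in>X. \<mu> x * (f x)\<^sup>2) - form i f f)"
proof -
  define g where "g i x y = f (take i y @ drop i x) - f (take (Suc i) y @ drop (Suc i) x)" for i x y
  have \<kappa>0: "(\<Sum>i<n. \<kappa> i) \<ge> 0" by (intro sum_nonneg) (auto intro: less_imp_le \<kappa>)
  have "(\<Sum>x\<in>X. \<mu> x * (f x)\<^sup>2) - (\<Sum>x\<in>X. \<mu> x * f x)\<^sup>2
    = 1 / 2 * (\<Sum>x\<in>X. \<Sum>y\<in>X. \<mu> x * \<mu> y * (f x - f y)\<^sup>2)"
    using variance_pairs[OF sum_\<mu>, of f] by simp
  also have "\<dots> \<le> 1 / 2 * (\<Sum>x\<in>X. \<Sum>y\<in>X. \<mu> x * \<mu> y * ((\<Sum>i<n. \<kappa> i) * (\<Sum>i<n. (g i x y)\<^sup>2 / \<kappa> i)))"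
  proof (intro mult_left_mono sum_mono)
    fix x y assume "x \<in> X" "y \<in> X"
    then have "f x - f y = (\<Sum>i<n. g i x y)"
      unfolding g_def by (subst sum_lessThan_telescope') (simp add: configs_def)
    then show "(f x - f y)\<^sup>2 \<le> (\<Sum>i<n. \<kappa> i) * (\<Sum>i<n. (g i x y)\<^sup>2 / \<kappa> i)"
      using weighted_Cauchy_Schwarz[of "{..<n}" \<kappa> "\<lambda>i. g i x y"] \<kappa> by simp
  qed (simp_all add: less_imp_le[OF \<mu>_pos])
  also have "\<dots> = (\<Sum>i<n. \<kappa> i) / 2 * (\<Sum>i<n. 1 / \<kappa> i * (\<Sum>x\<in>X. \<Sum>y\<in>X. \<mu> x * \<mu> y * (g i x y)\<^sup>2))"
    unfolding sum_distrib_left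
    by (subst sum_swap3) (intro sum.cong refl, simp)
  also have "\<dots> \<le> (\<Sum>i<n. \<kappa> i) / 2 * (\<Sum>i<n. 1 / \<kappa> i *
      (2 * \<kappa> i / K * ((\<Sum>x\<in>X. \<mu> x * (f x)\<^sup>2) - form i f f)))"
    unfolding g_def using \<kappa>0 \<kappa>
    by (intro mult_left_mono sum_mono replacement_le_local_variance bond) (auto intro: less_imp_le)
  also have "\<dots> = (\<Sum>i<n. \<kappa> i) / 2 * (\<Sum>i<n. 2 / K * ((\<Sum>x\<in>X. \<mu> x * (f x)\<^sup>2) - form i f f))"
    by (intro arg_cong[of _ _ "(*) ((\<Sum>i<n. \<kappa> i) / 2)"] sum.cong refl)
      (simp add: \<kappa>[THEN less_imp_neq, THEN not_sym])
  also have "\<dots> = (\<Sum>i<n. \<kappa> i) / K * (\<Sum>i<n. (\<Sum>x\<in>X. \<mu> x * (f x)\<^sup>2) - form i f f)"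
    unfolding sum_distrib_left[symmetric] by simp
  finally show ?thesis .
qed

text \<open>
  An eigenfunction \<open>f\<close> has Dirichlet form proportional to \<open>(1 - \<beta>) \<parallel>f\<parallel>\<^sup>2\<close>.  If \<open>f\<close> is not constant, the
  Poincare inequality forces \<open>\<beta> \<noteq> 1\<close>; then \<open>f\<close> is orthogonal to the constants, so its variance is
  \<open>\<parallel>f\<parallel>\<^sup>2\<close> and the inequality bounds \<open>1 - \<beta>\<close> from below.  Positivity of the forms gives \<open>\<beta> \<ge> 0\<close>.
\<close>

lemma eigenfunction_gap:
  assumes \<kappa>: "\<And>i. i < n \<Longrightarrow> \<kappa> i > 0"
    and bond: "\<And>i u a b v. \<lbrakk>i < n; u \<in> configs cs i; a \<in> C; b \<in> C; v \<in> configs cs (n - 1 - i)\<rbrakk> \<Longrightarrow>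
      (\<Sum>d\<in>C. path_weight q (u @ [d]) * path_weight q (d # v))
        \<le> \<kappa> i * (path_weight q (u @ [a]) * path_weight q (b # v))"
    and eig: "\<And>x. x \<in> X \<Longrightarrow> (\<Sum>i<n. resample i f x) / real n = \<beta> * f x"
    and non_const: "\<not> (\<exists>c. \<forall>x\<in>X. f x = c)"
  shows "0 \<le> \<beta>" and "K / (real n * (\<Sum>i<n. \<kappa> i)) \<le> 1 - \<beta>"
proof -
  define s where "s = (\<Sum>i<n. \<kappa> i)"
  define V where "V = (\<Sum>x\<in>X. \<mu> x * (f x)\<^sup>2)"
  define m where "m = (\<Sum>x\<in>X. \<mu> x * f x)"
  have n: "real n > 0" using sites by simp
  have s: "s > 0" unfolding s_def using sites by (intro sum_pos) (auto simp: \<kappa> lessThan_empty_iff)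
  have eig': "(\<Sum>i<n. resample i f x) = n * \<beta> * f x" if "x \<in> X" for x
    using eig[OF that] n by (simp add: field_simps)
  have form: "(\<Sum>i<n. form i f h) = n * \<beta> * (\<Sum>x\<in>X. \<mu> x * f x * h x)" for h
  proof -
    have "(\<Sum>i<n. form i f h) = (\<Sum>x\<in>X. \<mu> x * (\<Sum>i<n. resample i f x) * h x)"
      unfolding form_def by (subst sum.swap) (simp add: sum_distrib_left sum_distrib_right)
    then show ?thesis by (simp add: eig' sum_distrib_left mult_ac)
  qed
  have ff: "(\<Sum>i<n. form i f f) = n * \<beta> * V"
    using form[of f] by (simp add: V_def power2_eq_square mult_ac)
  obtain x0 where x0: "x0 \<in> X" "f x0 \<noteq> 0" using non_const by blast
  have V: "V > 0" unfolding V_def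
    by (rule sum_pos2[of _ x0]) (use x0 in \<open>auto simp: \<mu>_pos less_imp_le\<close>)
  have "0 \<le> n * \<beta> * V" unfolding ff[symmetric] by (intro sum_nonneg form_nonneg) auto
  then show "0 \<le> \<beta>" using V n by (simp add: zero_le_mult_iff)
  have var: "V - m\<^sup>2 \<le> s / K * (n * (1 - \<beta>) * V)"
    using poincare[of \<kappa> f, OF \<kappa> bond] unfolding V_def[symmetric] m_def[symmetric] s_def[symmetric]
    by (simp add: sum_subtractf ff algebra_simps)
  have "V - m\<^sup>2 > 0"
  proof -
    have e: "V - m\<^sup>2 = 1 / 2 * (\<Sum>x\<in>X. \<Sum>y\<in>X. \<mu> x * \<mu> y * (f x - f y)\<^sup>2)"
      using variance_pairs[OF sum_\<mu>, of f] by (simp add: V_def m_def)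
    obtain y0 where y0: "y0 \<in> X" "f y0 \<noteq> f x0" using non_const by blast
    have "(\<Sum>x\<in>X. \<Sum>y\<in>X. \<mu> x * \<mu> y * (f x - f y)\<^sup>2) > 0"
      using x0 y0 by (intro sum_pos2[of _ x0] sum_pos2[of _ y0] sum_nonneg)
        (auto simp: \<mu>_pos less_imp_le)
    then show ?thesis using e by simp
  qed
  then have "\<beta> \<noteq> 1" using var by auto
  have "n * m = n * \<beta> * m"
    using form[of "\<lambda>_. 1"] by (simp add: form_one m_def)
  then have "m = 0" using n \<open>\<beta> \<noteq> 1\<close> by simp
  then have "1 * V \<le> (s / K * (n * (1 - \<beta>))) * V" using var by (simp add: mult_ac)
  then have "1 \<le> s / K * (n * (1 - \<beta>))" using V by (simp only: mult_le_cancel_right_pos)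
  then show "K / (real n * (\<Sum>i<n. \<kappa> i)) \<le> 1 - \<beta>"
    unfolding s_def[symmetric] using s n K_pos by (simp add: field_simps)
qed

end

section \<open>The Ising weight as a chain of bonds\<close>

definition bond_weight :: "real \<Rightarrow> 'c \<Rightarrow> 'c \<Rightarrow> real" where
  "bond_weight T a b = (if a = b then exp (1 / T) else exp (- 1 / T))"

definition bond_total :: "real \<Rightarrow> 'c list \<Rightarrow> real" where
  "bond_total T cs = exp (1 / T) + (real (card (set cs)) - 1) * exp (- 1 / T)"

definition bond_kernel :: "real \<Rightarrow> 'c list \<Rightarrow> 'c \<Rightarrow> 'c \<Rightarrow> real" where
  "bond_kernel T cs a b = bond_weight T a b / bond_total T cs"

lemma sum_color_eq:
  fixes x y :: real
  assumes "a \<in> set cs"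
  shows "(\<Sum>b\<in>set cs. if a = b then x else y) = x + (real (card (set cs)) - 1) * y"
proof -
  have "(\<Sum>b\<in>set cs - {a}. if a = b then x else y) = (\<Sum>b\<in>set cs - {a}. y)"
    by (intro sum.cong) auto
  moreover have "card (set cs) \<ge> 1"
    using assms by (metis List.finite_set One_nat_def Suc_leI card_gt_0_iff empty_iff)
  ultimately show ?thesis
    using assms by (simp add: sum.remove[of _ a] of_nat_diff)
qed

lemma sum_bond_weight: "a \<in> set cs \<Longrightarrow> (\<Sum>b\<in>set cs. bond_weight T a b) = bond_total T cs"
  unfolding bond_weight_def bond_total_def by (rule sum_color_eq)

lemma bond_weight_pos: "bond_weight T a b > 0"
  by (simp add: bond_weight_def)

lemma bond_total_pos: "cs \<noteq> [] \<Longrightarrow> bond_total T cs > 0"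
  using sum_bond_weight[of "hd cs" cs T] sum_pos[of "set cs" "bond_weight T (hd cs)"]
  by (simp add: bond_weight_pos)

lemma bond_chain_bond_kernel:
  assumes "n \<ge> 1" "cs \<noteq> []"
  shows "bond_chain cs n (bond_kernel T cs)"
proof
  show "bond_kernel T cs a b > 0" for a b
    using assms by (simp add: bond_kernel_def bond_weight_pos bond_total_pos)
  show "bond_kernel T cs a b = bond_kernel T cs b a" for a b
    by (simp add: bond_kernel_def bond_weight_def)
  show "(\<Sum>b\<in>set cs. bond_kernel T cs a b) = 1" if "a \<in> set cs" for a
    using that bond_total_pos[OF assms(2), of T]
    by (simp add: bond_kernel_def sum_bond_weight flip: sum_divide_distrib)
qed (use assms in auto)

lemma ising_weight_Cons:
  "ising_weight (Suc (Suc m)) T (a # b # l) = bond_weight T a b * ising_weight (Suc m) T (b # l)"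
  by (simp add: ising_weight_def bond_weight_def sum.lessThan_Suc_shift distrib_left exp_add
      del: sum.lessThan_Suc)

lemma ising_weight_eq_path_weight:
  assumes "cs \<noteq> []"
  shows "length x = Suc m \<Longrightarrow> ising_weight (Suc m) T x = bond_total T cs ^ m * path_weight (bond_kernel T cs) x"
proof (induction x arbitrary: m rule: induct_list012)
  case (3 a b l)
  then obtain m' where m': "m = Suc m'" "length (b # l) = Suc m'" by (cases m) auto
  show ?case
    unfolding m'(1) ising_weight_Cons 3(2)[OF m'(2)]
    using bond_total_pos[OF assms, of T] by (simp add: bond_kernel_def[of T cs a b])
qed (auto simp: ising_weight_def)

section \<open>Replacement costs for the Ising bonds\<close>

text \<open>
  An upper bound for the cost of replacing the color of site \<open>i\<close> in a chain with \<open>N\<close> colors: the worst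
  case breaks one bond at the leftmost site and two bonds elsewhere.
\<close>

definition site_cost :: "real \<Rightarrow> nat \<Rightarrow> nat \<Rightarrow> real" where
  "site_cost T N i = exp ((if i = 0 then 2 else 4) / T) + (real N - 1)"

lemma bond_weight_ge: "T > 0 \<Longrightarrow> exp (- 1 / T) \<le> bond_weight T a b"
  by (simp add: bond_weight_def)

lemma inverse_bond_le:
  assumes "T > 0" "cs \<noteq> []"
  shows "1 \<le> site_cost T (card (set cs)) 0 * bond_kernel T cs a b"
proof -
  have "bond_total T cs = site_cost T (card (set cs)) 0 * exp (- 1 / T)"
    by (simp add: bond_total_def site_cost_def algebra_simps flip: exp_add add_divide_distrib)
  moreover have "site_cost T (card (set cs)) 0 \<ge> 0"
    using assms by (simp add: site_cost_def add_nonneg_nonneg card_gt_0_iff Suc_le_eq)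
  ultimately have "bond_total T cs \<le> site_cost T (card (set cs)) 0 * bond_weight T a b"
    using bond_weight_ge[OF assms(1), of a b] by (metis mult_left_mono)
  then show ?thesis
    using bond_total_pos[OF assms(2), of T] by (simp add: bond_kernel_def)
qed

text \<open>
  By \<open>2 s t \<le> s\<^sup>2 + t\<^sup>2\<close> the sum over \<open>d\<close>, taken with unnormalized bond weights, is at most its value
  for \<open>l = c\<close>, which is
  \<open>exp (2 / T) + (N - 1) exp (- 2 / T)\<close>.  This is the cost times the least value \<open>exp (- 2 / T)\<close> of a product
  of two bond weights.
\<close>

lemma two_bond_sum_le:
  assumes T: "T > 0" and cs: "cs \<noteq> []" and l: "l \<in> set cs" and c: "c \<in> set cs"
    and i: "i \<noteq> 0"
  shows "(\<Sum>d\<in>set cs. bond_kernel T cs l d * bond_kernel T cs d c)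
    \<le> site_cost T (card (set cs)) i * (bond_kernel T cs l a * bond_kernel T cs b c)"
proof -
  let ?g = "bond_weight T" and ?s = "bond_total T cs" and ?k = "site_cost T (card (set cs)) i"
  have W: "(\<Sum>d\<in>set cs. (?g e d)\<^sup>2) = ?k * exp (- 1 / T) * exp (- 1 / T)" if "e \<in> set cs" for e
  proof -
    have "(\<Sum>d\<in>set cs. (?g e d)\<^sup>2)
        = (\<Sum>d\<in>set cs. if e = d then (exp (1 / T))\<^sup>2 else (exp (- 1 / T))\<^sup>2)"
      by (intro sum.cong) (auto simp: bond_weight_def)
    also have "\<dots> = ?k * exp (- 1 / T) * exp (- 1 / T)"
      unfolding sum_color_eq[OF that] using i
      by (simp add: site_cost_def power2_eq_square algebra_simps flip: exp_add add_divide_distrib)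
    finally show ?thesis .
  qed
  have "(\<Sum>d\<in>set cs. ?g l d * ?g d c) \<le> (\<Sum>d\<in>set cs. ((?g l d)\<^sup>2 + (?g c d)\<^sup>2) / 2)"
  proof (intro sum_mono)
    fix d
    have "?g d c = ?g c d" by (simp add: bond_weight_def)
    then show "?g l d * ?g d c \<le> ((?g l d)\<^sup>2 + (?g c d)\<^sup>2) / 2"
      using sum_squares_bound[of "?g l d" "?g c d"] by simp
  qed
  also have "\<dots> = ?k * (exp (- 1 / T) * exp (- 1 / T))"
    by (simp add: W l c sum.distrib mult.assoc flip: sum_divide_distrib)
  also have "\<dots> \<le> ?k * (?g l a * ?g b c)"
    using cs T by (intro mult_left_mono mult_mono bond_weight_ge)
      (auto simp: bond_weight_pos less_imp_le site_cost_def add_nonneg_nonneg card_gt_0_iff Suc_le_eq)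
  finally have "(\<Sum>d\<in>set cs. ?g l d * ?g d c) / ?s\<^sup>2 \<le> ?k * (?g l a * ?g b c) / ?s\<^sup>2"
    by (rule divide_right_mono) simp
  then show ?thesis
    by (simp add: bond_kernel_def power2_eq_square sum_divide_distrib)
qed

text \<open>
  The path weights of the parts of \<open>u\<close> and \<open>v\<close> away from site \<open>i\<close> cancel, so only the bonds at \<open>i\<close>
  matter; there are at most two, fewer at the ends of the chain.
\<close>

lemma bond_condition:
  assumes T: "T > 0" and cs: "cs \<noteq> []" and i: "i < n"
    and u: "u \<in> configs cs i" and a: "a \<in> set cs" and b: "b \<in> set cs"
    and v: "v \<in> configs cs (n - 1 - i)"
  defines "p \<equiv> path_weight (bond_kernel T cs)"
  shows "(\<Sum>d\<in>set cs. p (u @ [d]) * p (d # v))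
    \<le> site_cost T (card (set cs)) i * (p (u @ [a]) * p (b # v))"
proof -
  interpret bond_chain cs n "bond_kernel T cs"
    using i cs by (intro bond_chain_bond_kernel) auto
  let ?k = "site_cost T (card (set cs))"
  have k0: "?k 0 \<le> ?k i"
    using T by (simp add: site_cost_def divide_right_mono)
  have p_pos: "p x > 0" for x unfolding p_def by (rule path_weight_pos)
  have one: "1 \<le> ?k j * bond_kernel T cs x y" if "j \<in> {0, i}" for j x y
  proof -
    have "?k 0 * bond_kernel T cs x y \<le> ?k j * bond_kernel T cs x y"
      using that k0 less_imp_le[OF q_pos] by (intro mult_right_mono) auto
    then show ?thesis using inverse_bond_le[OF T cs, of x y] by linarith
  qed
  show ?thesis
  proof (cases u rule: rev_cases)
    case Nil
    then have i0: "i = 0" using u by (simp add: configs_def)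
    show ?thesis
    proof (cases v)
      case v: Nil
      have "exp (2 / T) \<ge> 1" using T by simp
      then show ?thesis using Nil v i0 by (simp add: p_def site_cost_def)
    next
      case (Cons c v')
      then have c: "c \<in> set cs" using v by (simp add: configs_def)
      have "(\<Sum>d\<in>set cs. bond_kernel T cs d c * p (c # v')) = p (c # v')"
        using q_stoch[OF c] by (simp add: q_sym[of _ c] flip: sum_distrib_right)
      also have "\<dots> \<le> (?k i * bond_kernel T cs b c) * p (c # v')"
        using mult_right_mono[OF one[of i b c] less_imp_le[OF p_pos]] by simp
      finally show ?thesis using Nil Cons by (simp add: p_def mult_ac)
    qed
  next
    case (snoc u' l)
    then have l: "l \<in> set cs" and i0: "i \<noteq> 0" using u by (auto simp: configs_def)
    have pu: "p (u @ [d]) = p (u' @ [l]) * bond_kernel T cs l d" for d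
      by (simp add: snoc p_def path_weight_snoc)
    show ?thesis
    proof (cases v)
      case Nil
      have "(\<Sum>d\<in>set cs. p (u' @ [l]) * bond_kernel T cs l d) = p (u' @ [l])"
        using q_stoch[OF l] by (simp flip: sum_distrib_left)
      also have "\<dots> \<le> (?k i * bond_kernel T cs l a) * p (u' @ [l])"
        using mult_right_mono[OF one[of i l a] less_imp_le[OF p_pos]] by simp
      finally show ?thesis unfolding pu Nil by (simp add: p_def mult_ac)
    next
      case (Cons c v')
      then have c: "c \<in> set cs" using v by (simp add: configs_def)
      have pv: "p (d # v) = bond_kernel T cs d c * p (c # v')" for d
        by (simp add: Cons p_def)
      have "(\<Sum>d\<in>set cs. p (u @ [d]) * p (d # v))
          = (\<Sum>d\<in>set cs. bond_kernel T cs l d * bond_kernel T cs d c) * (p (u' @ [l]) * p (c # v'))"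
        unfolding pu pv sum_distrib_right by (simp add: mult_ac)
      also have "\<dots> \<le> ?k i * (bond_kernel T cs l a * bond_kernel T cs b c) * (p (u' @ [l]) * p (c # v'))"
        using p_pos[of "u' @ [l]"] p_pos[of "c # v'"]
        by (intro mult_right_mono two_bond_sum_le T cs l c i0) simp
      finally show ?thesis unfolding pu pv by (simp add: mult_ac)
    qed
  qed
qed

section \<open>The Gibbs sampler averages the single-site resamplings\<close>

lemma differ_only_at_unique: "differ_only_at n x y i \<Longrightarrow> differ_only_at n x y j \<Longrightarrow> i = j"
  by (auto simp: differ_only_at_def)

lemma differ_only_at_commute: "differ_only_at n x y i = differ_only_at n y x i"
  by (auto simp: differ_only_at_def)

lemma list_update_eq_iff_differ_only_at:
  assumes "length x = n" "length y = n" "i < n" "c \<noteq> x ! i"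
  shows "x[i := c] = y \<longleftrightarrow> differ_only_at n x y i \<and> c = y ! i"
  using assms by (auto simp: differ_only_at_def list_eq_iff_nth_eq nth_list_update)

lemma gibbs_differ_only_at:
  assumes "differ_only_at n x y i"
  shows "gibbs cs n T x y = ising_cond cs n T x i (y ! i) / real n"
proof -
  have "(THE i. differ_only_at n x y i) = i"
    using assms by (auto intro: differ_only_at_unique)
  moreover have "x \<noteq> y" using assms by (auto simp: differ_only_at_def)
  ultimately show ?thesis using assms by (auto simp: gibbs_def)
qed

text \<open>
  Replacing the choice of the differing site by a sum over all single-site changes turns the action
  of the transition matrix on functions into a sum over sites and colors.  At most one summand is
  nonzero.
\<close>

lemma gibbs_off_diagonal:
  assumes "x \<in> configs cs n" "y \<in> configs cs n" "x \<noteq> y"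
  shows "gibbs cs n T x y
    = (\<Sum>i<n. \<Sum>c\<in>set cs - {x ! i}. if x[i := c] = y then ising_cond cs n T x i c / real n else 0)"
proof -
  have eq: "(if x[i := c] = y then ising_cond cs n T x i c / real n else 0)
      = (if c = y ! i then (if differ_only_at n x y i then gibbs cs n T x y else 0) else 0)"
    if "i < n" "c \<in> set cs - {x ! i}" for i c
    using that assms(1,2) list_update_eq_iff_differ_only_at[of x n y i c]
    by (auto simp: configs_def gibbs_differ_only_at)
  have inner: "(\<Sum>c\<in>set cs - {x ! i}. if x[i := c] = y then ising_cond cs n T x i c / real n else 0)
      = (if differ_only_at n x y i then gibbs cs n T x y else 0)" if "i < n" for i
  proof -
    have "y ! i \<in> set cs" using that assms(2) by (auto simp: configs_def)
    have "(\<Sum>c\<in>set cs - {x ! i}. if x[i := c] = y then ising_cond cs n T x i c / real n else 0)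
      = (\<Sum>c\<in>set cs - {x ! i}.
        if c = y ! i then (if differ_only_at n x y i then gibbs cs n T x y else 0) else 0)"
      by (rule sum.cong[OF refl eq[OF that]])
    also have "\<dots> = (if differ_only_at n x y i then gibbs cs n T x y else 0)"
      using \<open>y ! i \<in> set cs\<close> by (auto simp: differ_only_at_def)
    finally show ?thesis .
  qed
  show ?thesis
  proof (cases "\<exists>i. differ_only_at n x y i")
    case True
    then obtain i where i: "differ_only_at n x y i" by blast
    then have "differ_only_at n x y j \<longleftrightarrow> j = i" for j by (auto dest: differ_only_at_unique)
    moreover have "i < n" using i by (simp add: differ_only_at_def)
    ultimately show ?thesis by (simp add: inner)
  next
    case False
    then have "gibbs cs n T x y = 0" using assms(3) by (auto simp: gibbs_def)
    then show ?thesis by (simp add: inner)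
  qed
qed

context
  fixes cs :: "'c list" and n :: nat and T :: real
  assumes n: "n \<ge> 1" and cs: "cs \<noteq> []"
begin

interpretation bond_chain cs n "bond_kernel T cs"
  using n cs by (rule bond_chain_bond_kernel)

lemma ising_eq_\<mu>:
  assumes "x \<in> configs cs n"
  shows "ising cs n T x = \<mu> x"
proof -
  let ?z = "bond_total T cs ^ (n - 1)"
  have w: "ising_weight n T x = ?z * (K * \<mu> x)" if "x \<in> configs cs n" for x
    using ising_weight_eq_path_weight[OF cs, of x "n - 1" T] that n cs
    by (simp add: configs_def \<mu>_def)
  have "(\<Sum>x\<in>X. ising_weight n T x) = ?z * K"
    using sum_\<mu> by (simp add: w flip: sum_distrib_left)
  then show ?thesis using bond_total_pos[OF cs, of T] cs by (simp add: ising_def w[OF assms])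
qed

lemma update_in_configs: "x \<in> configs cs n \<Longrightarrow> c \<in> set cs \<Longrightarrow> x[i := c] \<in> configs cs n"
  by (auto simp: configs_def dest: set_update_subset_insert[THEN subsetD])

lemma ising_cond_eq:
  assumes "x \<in> configs cs n" "c \<in> set cs"
  shows "ising_cond cs n T x i c = \<mu> (x[i := c]) / (\<Sum>d\<in>set cs. \<mu> (x[i := d]))"
  using assms by (simp add: ising_cond_def ising_eq_\<mu> update_in_configs)

lemma resample_eq_sum_ising_cond:
  assumes x: "x \<in> configs cs n" and i: "i < n"
  shows "resample i f x
    = f x + (\<Sum>c\<in>set cs - {x ! i}. ising_cond cs n T x i c * (f (x[i := c]) - f x))"
proof -
  let ?M = "\<Sum>d\<in>set cs. \<mu> (x[i := d])"
  have "resample i f x = (\<Sum>c\<in>set cs. ising_cond cs n T x i c * f (x[i := c]))"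
    using x by (simp add: resample_def ising_cond_eq sum_divide_distrib)
  also have "\<dots> = (\<Sum>c\<in>set cs. ising_cond cs n T x i c) * f x
      + (\<Sum>c\<in>set cs. ising_cond cs n T x i c * (f (x[i := c]) - f x))"
    by (simp add: right_diff_distrib sum_subtractf sum_distrib_right)
  also have "(\<Sum>c\<in>set cs. ising_cond cs n T x i c) = 1"
    using x marginal_pos[of "\<lambda>c. x[i := c]"] by (simp add: ising_cond_eq flip: sum_divide_distrib)
  also have "(\<Sum>c\<in>set cs. ising_cond cs n T x i c * (f (x[i := c]) - f x))
      = (\<Sum>c\<in>set cs - {x ! i}. ising_cond cs n T x i c * (f (x[i := c]) - f x))"
    by (rule sum.mono_neutral_right) auto
  finally show ?thesis by simp
qed

lemma gibbs_action:
  assumes x: "x \<in> configs cs n"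
  shows "(\<Sum>y\<in>configs cs n. gibbs cs n T x y * f y) = (\<Sum>i<n. resample i f x) / real n"
proof -
  let ?c = "ising_cond cs n T x"
  have "(\<Sum>y\<in>X - {x}. gibbs cs n T x y * f y) = (\<Sum>y\<in>X - {x}. \<Sum>i<n. \<Sum>c\<in>set cs - {x ! i}.
      if y = x[i := c] then ?c i c / real n * f (x[i := c]) else 0)"
  proof (rule sum.cong[OF refl])
    fix y assume y: "y \<in> X - {x}"
    have "gibbs cs n T x y * f y = (\<Sum>i<n. \<Sum>c\<in>set cs - {x ! i}.
        (if x[i := c] = y then ?c i c / real n else 0) * f y)"
      using x y by (subst gibbs_off_diagonal) (auto simp: sum_distrib_right)
    also have "\<dots> = (\<Sum>i<n. \<Sum>c\<in>set cs - {x ! i}.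
        if y = x[i := c] then ?c i c / real n * f (x[i := c]) else 0)"
      by (intro sum.cong refl) simp
    finally show "gibbs cs n T x y * f y = \<dots>" .
  qed
  also have "\<dots> = (\<Sum>i<n. \<Sum>c\<in>set cs - {x ! i}. \<Sum>y\<in>X - {x}.
      if y = x[i := c] then ?c i c / real n * f (x[i := c]) else 0)"
    by (subst sum.swap, intro sum.cong[OF refl], rule sum.swap)
  also have "\<dots> = (\<Sum>i<n. \<Sum>c\<in>set cs - {x ! i}. ?c i c / real n * f (x[i := c]))"
  proof (intro sum.cong refl)
    fix i c assume *: "i \<in> {..<n}" "c \<in> set cs - {x ! i}"
    then have "x[i := c] ! i \<noteq> x ! i" using x by (simp add: configs_def)
    then have "x[i := c] \<noteq> x" by metis
    moreover have "x[i := c] \<in> X" using * x by (simp add: update_in_configs)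
    ultimately show "(\<Sum>y\<in>X - {x}. if y = x[i := c] then ?c i c / real n * f (x[i := c]) else 0)
      = ?c i c / real n * f (x[i := c])" by simp
  qed
  finally have off: "(\<Sum>y\<in>X - {x}. gibbs cs n T x y * f y)
    = (\<Sum>i<n. \<Sum>c\<in>set cs - {x ! i}. ?c i c * f (x[i := c])) / real n"
    by (simp add: sum_divide_distrib)
  have "(\<Sum>y\<in>X. gibbs cs n T x y * f y)
    = gibbs cs n T x x * f x + (\<Sum>y\<in>X - {x}. gibbs cs n T x y * f y)"
    using x by (simp add: sum.remove)
  also have "\<dots> = f x + (\<Sum>i<n. \<Sum>c\<in>set cs - {x ! i}. ?c i c * (f (x[i := c]) - f x)) / real n"
    unfolding off
    by (simp add: gibbs_def right_diff_distrib sum_subtractf sum_distrib_right diff_divide_distrib left_diff_distrib)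
  also have "\<dots> = (\<Sum>i<n. resample i f x) / real n"
    using n by (simp add: resample_eq_sum_ising_cond[OF x] sum.distrib add_divide_distrib)
  finally show ?thesis .
qed

lemma gibbs_reversible:
  assumes x: "x \<in> configs cs n" and y: "y \<in> configs cs n"
  shows "\<mu> x * gibbs cs n T x y = \<mu> y * gibbs cs n T y x"
proof (cases "\<exists>i. differ_only_at n x y i")
  case True
  then obtain i where i: "differ_only_at n x y i" by blast
  then have i': "differ_only_at n y x i" by (simp add: differ_only_at_commute)
  have xy: "x[i := y ! i] = y" "y[i := x ! i] = x"
    using i i' x y list_update_eq_iff_differ_only_at[of x n y i "y ! i"]
      list_update_eq_iff_differ_only_at[of y n x i "x ! i"]
    by (auto simp: configs_def differ_only_at_def)
  then have "y[i := d] = x[i := d]" for d by (metis list_update_overwrite)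
  moreover have "x ! i \<in> set cs" "y ! i \<in> set cs"
    using i x y by (auto simp: configs_def differ_only_at_def)
  ultimately show ?thesis
    using x y by (simp add: gibbs_differ_only_at[OF i] gibbs_differ_only_at[OF i'] ising_cond_eq xy)
next
  case False
  then have "x = y \<or> gibbs cs n T x y = 0 \<and> gibbs cs n T y x = 0"
    using differ_only_at_commute[of n x y] by (auto simp: gibbs_def)
  then show ?thesis by auto
qed

text \<open>
  The total cost is strictly below \<open>n * \<kappa>\<close> because the leftmost site is strictly cheaper than the
  others.
\<close>

lemma gibbs_eigenfunction_gap:
  assumes T: "T > 0"
    and eig: "\<And>x. x \<in> configs cs n \<Longrightarrow> (\<Sum>y\<in>configs cs n. gibbs cs n T x y * f y) = \<beta> * f x"
    and non_const: "\<not> (\<exists>c. \<forall>x\<in>configs cs n. f x = c)"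
  shows "\<bar>\<beta>\<bar> < 1 - real (card (set cs)) / (real n)\<^sup>2 *
    (exp (- 4 / T) / (1 + (real (card (set cs)) - 1) * exp (- 4 / T)))"
proof -
  let ?k = "site_cost T (card (set cs))"
  define \<kappa> where "\<kappa> = exp (4 / T) + (K - 1)"
  have card: "card (set cs) \<ge> 1" using cs by (simp add: Suc_le_eq card_gt_0_iff)
  have k_pos: "?k i > 0" for i using card by (simp add: site_cost_def add_pos_nonneg)
  have \<kappa>: "\<kappa> > 0" using card by (simp add: \<kappa>_def add_pos_nonneg)
  have "(\<Sum>i<n. ?k i) < (\<Sum>i<n. \<kappa>)"
    by (rule sum_strict_mono_ex1)
      (use n T in \<open>auto simp: site_cost_def \<kappa>_def divide_right_mono divide_strict_right_mono intro!: bexI[of _ 0]\<close>)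
  moreover have "(\<Sum>i<n. ?k i) > 0" using n by (intro sum_pos k_pos) (auto simp: lessThan_empty_iff)
  ultimately have "K / (real n * (n * \<kappa>)) < K / (real n * (\<Sum>i<n. ?k i))"
    using n K_pos \<kappa> by (intro divide_strict_left_mono mult_strict_left_mono mult_pos_pos) auto
  also have "\<dots> \<le> 1 - \<beta>"
    by (rule eigenfunction_gap(2)[of ?k f \<beta>])
      (use assms in \<open>auto intro: bond_condition k_pos simp flip: gibbs_action\<close>)
  finally have "\<beta> < 1 - K / (real n * (n * \<kappa>))" by simp
  also have "K / (real n * (n * \<kappa>))
      = K / (real n)\<^sup>2 * (exp (- 4 / T) / (1 + (K - 1) * exp (- 4 / T)))"
  proof -
    have "exp (- 4 / T) * \<kappa> = 1 + (K - 1) * exp (- 4 / T)"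
      by (simp add: \<kappa>_def algebra_simps flip: exp_add)
    then have "exp (- 4 / T) / (1 + (K - 1) * exp (- 4 / T)) = 1 / \<kappa>"
      by (metis exp_not_eq_zero nonzero_divide_mult_cancel_left)
    then show ?thesis by (simp add: power2_eq_square)
  qed
  finally have "\<beta> < 1 - K / (real n)\<^sup>2 * (exp (- 4 / T) / (1 + (K - 1) * exp (- 4 / T)))" .
  moreover have "0 \<le> \<beta>"
    by (rule eigenfunction_gap(1)[of ?k f \<beta>])
      (use assms in \<open>auto intro: bond_condition k_pos simp flip: gibbs_action\<close>)
  ultimately show ?thesis by simp
qed

end

section \<open>The spectrum of the transition matrix\<close>

text \<open>
  Vectors indexed by the positions in the list of configurations are identified with functions on
  configurations.  The gap, which is positive, excludes nonconstant eigenfunctions for the eigenvalue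
  \<open>1\<close>, so its eigenspace is the line of constants and it is a simple root.
\<close>

lemma gibbs_spectrum:
  fixes cs :: "'c list" and n :: nat and T :: real
  assumes n: "n \<ge> 1" and cs: "distinct cs" "cs \<noteq> []" and T: "T > 0"
  defines "A \<equiv> gibbs_matrix cs n T"
  shows "size (proots (char_poly A)) = card (configs cs n)"
    and "count (proots (char_poly A)) 1 = 1"
    and "\<And>e. e \<in># proots (char_poly A) \<Longrightarrow> e \<noteq> 1 \<Longrightarrow> \<bar>e\<bar> < 1 - real (card (set cs)) / (real n)\<^sup>2 *
      (exp (- 4 / T) / (1 + (real (card (set cs)) - 1) * exp (- 4 / T)))"
proof -
  interpret bond_chain cs n "bond_kernel T cs"
    using n cs(2) by (rule bond_chain_bond_kernel)
  define Y where "Y = List.n_lists n cs"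
  define m where "m = length Y"
  have Y: "set Y = X" "distinct Y"
    using cs by (simp_all add: Y_def set_n_lists_eq_configs distinct_n_lists)
  then have m: "m = card X" by (metis distinct_card m_def)
  have bij: "bij_betw ((!) Y) {..<m} X"
    using bij_betw_nth[OF Y(2) _ Y(1)[symmetric]] m_def by simp
  have A: "A \<in> carrier_mat m m"
    by (simp add: A_def gibbs_matrix_def m_def Y_def Let_def)
  have Aij: "A $$ (i, j) = gibbs cs n T (Y ! i) (Y ! j)" if "i < m" "j < m" for i j
    using that by (simp add: A_def gibbs_matrix_def m_def Y_def Let_def)
  have Yi: "Y ! i \<in> X" if "i < m" for i
    using that unfolding m_def Y(1)[symmetric] by (rule nth_mem)
  define d where "d i = \<mu> (Y ! i)" for i
  have d: "d i > 0" for i by (simp add: d_def \<mu>_pos)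
  have rev: "d i * A $$ (i, j) = d j * A $$ (j, i)" if "i < m" "j < m" for i j
    using gibbs_reversible[OF n cs(2) Yi[OF that(1)] Yi[OF that(2)]] that by (simp add: d_def Aij)
  \<comment> \<open>The function on configurations whose value at the \<open>i\<close>-th configuration is \<open>v i\<close>.\<close>
  define lift where "lift v x = v (the_inv_into {..<m} ((!) Y) x)" for v :: "nat \<Rightarrow> real" and x
  have lift: "lift v (Y ! i) = v i" if "i < m" for v i
    using that bij by (simp add: lift_def the_inv_into_f_f bij_betw_def)
  have action: "(\<Sum>y\<in>X. gibbs cs n T (Y ! i) y * lift v y) = (\<Sum>j<m. A $$ (i, j) * v j)"
    if "i < m" for v i
    using sum.reindex_bij_betw[OF bij, of "\<lambda>y. gibbs cs n T (Y ! i) y * lift v y"] that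
    by (simp add: Aij lift)
  have gap: "\<bar>e\<bar> < 1 - K / (real n)\<^sup>2 * (exp (- 4 / T) / (1 + (K - 1) * exp (- 4 / T)))"
    if ev: "\<And>i. i < m \<Longrightarrow> (\<Sum>j<m. A $$ (i, j) * v j) = e * v i"
      and nc: "\<not> (\<exists>c. \<forall>i<m. v i = c)" for e v
  proof (rule gibbs_eigenfunction_gap[OF n cs(2) T, of "lift v"])
    fix x assume "x \<in> X"
    then obtain i where "x = Y ! i" "i < m" using Y(1) m_def by (metis in_set_conv_nth)
    then show "(\<Sum>y\<in>X. gibbs cs n T x y * lift v y) = e * lift v x"
      using ev by (simp add: action lift)
  next
    show "\<not> (\<exists>c. \<forall>x\<in>X. lift v x = c)" using nc Yi lift by metis
  qed
  have bound_lt: "1 - K / (real n)\<^sup>2 * (exp (- 4 / T) / (1 + (K - 1) * exp (- 4 / T))) < 1"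
  proof -
    have "K \<ge> 1" using K_pos by simp
    then show ?thesis using n K_pos by (auto intro!: mult_pos_pos divide_pos_pos add_pos_nonneg)
  qed
  have nz: "char_poly A \<noteq> 0" using degree_monic_char_poly[OF A] by auto
  from char_poly_reversible_splits[OF A d rev] obtain es
    where es: "char_poly A = (\<Prod>e\<leftarrow>es. [:- e, 1:])" "length es = m" by blast
  show "size (proots (char_poly A)) = card X"
    using es m proots_prod_linear[of es] by simp
  have le: "count (proots (char_poly A)) 1 \<le> 1"
  proof (rule count_proots_char_poly_reversible_le_1[OF A d rev, where u = "\<lambda>_. 1"])
    fix v assume "\<And>i. i < m \<Longrightarrow> (\<Sum>j<m. A $$ (i, j) * v j) = 1 * v i"
    then show "\<exists>c. \<forall>i<m. v i = c * 1" using gap[of v 1] bound_lt by fastforce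
  qed
  have m_pos: "m > 0" using sum_\<mu> m by (auto simp: card_gt_0_iff)
  have row: "(\<Sum>j<m. A $$ (i, j)) = 1" if "i < m" for i
  proof -
    have "(\<Sum>y\<in>X. gibbs cs n T (Y ! i) y) = 1"
      using gibbs_action[OF n cs(2) Yi[OF that], of T "\<lambda>_. 1"] n by (simp add: resample_const)
    then show ?thesis using action[OF that, of "\<lambda>_. 1"] by (simp add: lift_def)
  qed
  have "eigenvector A (vec m (\<lambda>_. 1)) 1"
  proof -
    have "vec m (\<lambda>_. 1 :: real) \<noteq> 0\<^sub>v m" using m_pos by (metis index_vec index_zero_vec(1) zero_neq_one)
    moreover have "A *\<^sub>v vec m (\<lambda>_. 1) = 1 \<cdot>\<^sub>v vec m (\<lambda>_. 1)"
      using A row by (intro eq_vecI) (auto simp: scalar_prod_def lessThan_atLeast0)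
    ultimately show ?thesis using A by (simp add: eigenvector_def)
  qed
  then have "poly (char_poly A) 1 = 0"
    using eigenvalue_root_char_poly[OF A] by (auto simp: eigenvalue_def)
  then have "1 \<in># proots (char_poly A)" using nz by simp
  then show "count (proots (char_poly A)) 1 = 1"
    using le by (simp only: le_antisym count_greater_eq_one_iff[symmetric])
  fix e assume e: "e \<in># proots (char_poly A)" "e \<noteq> 1"
  then have "eigenvalue A e" using nz eigenvalue_root_char_poly[OF A] by simp
  then obtain v where v: "v \<in> carrier_vec m" "v \<noteq> 0\<^sub>v m" "A *\<^sub>v v = e \<cdot>\<^sub>v v"
    using A unfolding eigenvalue_def eigenvector_def by auto
  have ev: "(\<Sum>j<m. A $$ (i, j) * v $ j) = e * v $ i" if "i < m" for i
  proof -
    have "(A *\<^sub>v v) $ i = (\<Sum>j<m. A $$ (i, j) * v $ j)"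
      using that A v(1) by (auto simp: scalar_prod_def lessThan_atLeast0 intro!: sum.cong)
    then show ?thesis using v that by simp
  qed
  show "\<bar>e\<bar> < 1 - K / (real n)\<^sup>2 * (exp (- 4 / T) / (1 + (K - 1) * exp (- 4 / T)))"
  proof (rule gap[of "\<lambda>i. v $ i", OF ev])
    show "\<not> (\<exists>c. \<forall>i<m. v $ i = c)"
    proof
      assume "\<exists>c. \<forall>i<m. v $ i = c"
      then obtain c where c: "\<And>i. i < m \<Longrightarrow> v $ i = c" by blast
      have "(\<Sum>j<m. A $$ (0, j)) * c = e * c"
        using ev[OF m_pos] by (simp add: c m_pos sum_distrib_right)
      then have "c = 0" using row[OF m_pos] e(2) by simp
      then have "v = 0\<^sub>v m" using v(1) c by (intro eq_vecI) auto
      with v(2) show False by simp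
    qed
  qed
qed

theorem corollary1:
  fixes cs :: "'c list" and n N :: nat and T :: real and \<beta> :: "real list"
  assumes "n \<ge> 1" and "N \<ge> 3" and "T > 0"
    and "distinct cs" and "length cs = N"
    and "\<beta> = eigenvalues_desc (gibbs_matrix cs n T)"
  shows "length \<beta> = card (configs cs n) \<and> sorted_wrt (\<ge>) \<beta> \<and>
    \<beta> ! 0 = 1 \<and> \<beta> ! 1 < \<beta> ! 0 \<and> \<beta> ! (card (configs cs n) - 1) > -1 \<and>
    (\<forall>j\<in>{1..card (configs cs n) - 1}.
       \<bar>\<beta> ! j\<bar> < 1 - real N / (real n)\<^sup>2 * (exp (- 4 / T) / (1 + (real N - 1) * exp (- 4 / T)))) \<and>
    (N = 3 \<longrightarrow> (\<forall>j\<in>{1..card (configs cs n) - 1}.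
       \<bar>\<beta> ! j\<bar> < 1 - 3 / (real n)\<^sup>2 * (exp (- 4 / T) / (1 + 2 * exp (- 4 / T)))))"
proof -
  define b where "b = 1 - real N / (real n)\<^sup>2 * (exp (- 4 / T) / (1 + (real N - 1) * exp (- 4 / T)))"
  let ?m = "card (configs cs n)"
  have cs: "cs \<noteq> []" "card (set cs) = N" using assms by (auto simp: distinct_card)
  note spec = gibbs_spectrum[OF assms(1,4) cs(1) assms(3), unfolded cs(2), folded b_def]
  have b1: "b < 1"
    unfolding b_def using assms(1,2) by (auto intro!: mult_pos_pos divide_pos_pos add_pos_nonneg)
  have mset: "mset \<beta> = proots (char_poly (gibbs_matrix cs n T))"
    using assms(6) by (simp add: eigenvalues_desc_def)
  have len: "length \<beta> = ?m" using spec(1) by (metis mset size_mset)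
  have m: "?m \<ge> 2"
  proof -
    have "N \<le> N ^ n" using assms(1,2) by (simp add: self_le_power)
    moreover have "?m = N ^ n"
      using card_lists_length_eq[of "set cs" n] cs(2) by (simp add: configs_def conj_commute)
    ultimately show ?thesis using assms(2) by linarith
  qed
  have sorted: "sorted_wrt (\<ge>) \<beta>"
    using assms(6) by (simp add: eigenvalues_desc_def sorted_wrt_rev)
  obtain x \<gamma> where \<beta>: "\<beta> = x # \<gamma>" using len m by (cases \<beta>) auto
  have small: "\<bar>e\<bar> < b" if "e \<in> set \<beta>" "e \<noteq> 1" for e
    using spec(3)[of e] that mset by (metis set_mset_mset)
  have one: "count (mset \<beta>) 1 = 1" using spec(2) mset by simp
  then have "1 \<in> set \<beta>" by (metis count_greater_zero_iff less_one set_mset_mset)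
  then have "x \<ge> 1" using sorted \<beta> by auto
  then have x: "x = 1" using small[of x] b1 \<beta> by fastforce
  \<comment> \<open>As a simple root, \<open>1\<close> occurs only at the head of the decreasing list.\<close>
  then have "1 \<notin> set \<gamma>" using one \<beta> by (simp add: count_eq_zero_iff)
  then have rest: "\<bar>\<beta> ! j\<bar> < b" if "j \<in> {1..?m - 1}" for j
  proof -
    have "\<beta> ! j = \<gamma> ! (j - 1)" "j - 1 < length \<gamma>" using that \<beta> len m by (auto simp: nth_Cons')
    then have "\<beta> ! j \<in> set \<gamma>" by simp
    then show ?thesis using \<open>1 \<notin> set \<gamma>\<close> \<beta> by (intro small) auto
  qed
  have "1 \<in> {1..?m - 1}" "?m - 1 \<in> {1..?m - 1}" using m by auto
  then have "\<bar>\<beta> ! 1\<bar> < 1" "\<bar>\<beta> ! (?m - 1)\<bar> < 1" using rest b1 by (meson less_trans)+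
  then have "\<beta> ! 1 < \<beta> ! 0" "\<beta> ! (?m - 1) > - 1" using x \<beta> by (auto simp: abs_less_iff)
  moreover have "N = 3 \<longrightarrow> b = 1 - 3 / (real n)\<^sup>2 * (exp (- 4 / T) / (1 + 2 * exp (- 4 / T)))"
    by (simp add: b_def)
  ultimately show ?thesis
    using len sorted rest x \<beta> unfolding b_def by auto
qed

end
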